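(* Let $(p_a,Q_a)$ and $(p_b,Q_b)$ be two equivalent $n$-CPH (Coxian phase-type of order $n$) distributions, and let $M$ be a transformation matrix between them. Then $M$ is lower triangular and its first row equals $(1,0,\dots,0)$.
   Context: An $n$-CPH (Coxian phase-type) distribution of order $n$ is given by a pair $(p,Q)$ with initial row vector $p=(1,0,\dots,0)\in\mathbb{R}^n$ and $n\times n$ upper bidiagonal generator $Q$ whose diagonal entries are $Q_{ii}=-(\lambda_i+\mu_i)$ for $1\le i\le n-1$ and $Q_{nn}=-\mu_n$, whose superdiagonal entries are $Q_{i,i+1}=\lambda_i$ for $1\le i\le n-1$, and whose other entries are zero. Here $\lambda_i>0$ for $1\le i\le n-1$ and $\mu_i\ge 0$ for all $i$, with $\mu_n>0$; in particular all diagonal and superdiagonal entries of $Q$ are non-zero. The absorbing rate vector is $q=(\mu_1,\dots,\mu_n)^T=-Q\mathbb{1}$, where $\mathbb{1}$ is the column vector of ones, and the density is $f(t)=p e^{Qt}q$, $t\ge 0$. Two $n$-CPH distributions $(p_a,Q_a)$ and $(p_b,Q_b)$ (with absorbing rate vectors $q_a,q_b$) are equivalent if their densities coincide: $p_ae^{Q_at}q_a=p_be^{Q_bt}q_b$ for all $t\ge 0$. A transformation matrix between them is a non-singular $n\times n$ real matrix $M$ with $p_aM=p_b$, $Q_b=M^{-1}Q_aM$, and $Mq_b=q_a$. *)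

theory Defs
  imports "HOL-Analysis.Analysis" "Jordan_Normal_Form.Jordan_Normal_Form"
begin

(* Indices are shifted by one: lam i and mu i are the rates of phase i + 1.  Row vectors are
   1 x n matrices and column vectors are n x 1 matrices. *)

definition coxian_generator :: "nat \<Rightarrow> (nat \<Rightarrow> real) \<Rightarrow> (nat \<Rightarrow> real) \<Rightarrow> real mat" where
  "coxian_generator n lam mu = mat n n (\<lambda>(i, j).
     if j = i then (if i < n - 1 then - (lam i + mu i) else - mu i)
     else if j = Suc i then lam i
     else 0)"

definition is_cph :: "nat \<Rightarrow> real mat \<Rightarrow> real mat \<Rightarrow> bool" where
  "is_cph n p Q \<longleftrightarrow>
     1 \<le> n \<and>
     p = mat 1 n (\<lambda>(i, j). if j = 0 then 1 else 0) \<and>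
     (\<exists>lam mu. (\<forall>i < n - 1. 0 < lam i) \<and> (\<forall>i < n. 0 \<le> mu i) \<and> 0 < mu (n - 1) \<and>
        Q = coxian_generator n lam mu)"

definition absorbing_rates :: "real mat \<Rightarrow> real mat" where
  "absorbing_rates Q = - (Q * mat (dim_col Q) 1 (\<lambda>_. 1))"

lemma absorbing_rates_coxian_generator:
  "absorbing_rates (coxian_generator n lam mu) = mat n 1 (\<lambda>(i, j). mu i)"
proof (rule eq_matI)
  fix i j assume "i < dim_row (mat n 1 (\<lambda>(i, j). mu i))" "j < dim_col (mat n 1 (\<lambda>(i, j). mu i))"
  then have i: "i < n" and j: "j = 0" by auto
  let ?g = "\<lambda>k. if k = i then (if i < n - 1 then - (lam i + mu i) else - mu i)
     else if k = Suc i then lam i else 0"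
  have "(\<Sum>k = 0..<n. ?g k) = (\<Sum>k = 0..<n. (if k = i then (if i < n - 1 then - (lam i + mu i) else - mu i) else 0)
     + (if k = Suc i then lam i else 0))"
    by (rule sum.cong) auto
  also have "\<dots> = - mu i" using i by (auto simp: sum.distrib)
  finally have "(\<Sum>k = 0..<n. ?g k) = - mu i" .
  then show "absorbing_rates (coxian_generator n lam mu) $$ (i, j) = mat n 1 (\<lambda>(i, j). mu i) $$ (i, j)"
    using i j by (simp add: absorbing_rates_def coxian_generator_def scalar_prod_def)
qed (auto simp: absorbing_rates_def coxian_generator_def)

(* The entrywise exponential series; it converges for every square matrix by summable_mat_exp. *)
definition mat_exp :: "real mat \<Rightarrow> real mat" where
  "mat_exp A = mat (dim_row A) (dim_row A) (\<lambda>(i, j). \<Sum>k. (A ^\<^sub>m k) $$ (i, j) / fact k)"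

lemma summable_mat_exp:
  assumes A: "A \<in> carrier_mat n n" and i: "i < n" and j: "j < n"
  shows "summable (\<lambda>k. (A ^\<^sub>m k) $$ (i, j) / fact k :: real)"
proof -
  obtain c where c: "norm_bound A c" using norm_bound_max by blast
  have b: "norm_bound (A ^\<^sub>m k) ((c * real n) ^ k)" for k
  proof (induction k)
    case 0
    show ?case using A by (auto simp: norm_bound_def)
  next
    case (Suc k)
    have "norm_bound (A ^\<^sub>m k * A) ((c * real n) ^ k * c * real n)"
      by (rule norm_bound_mult[OF _ A Suc c]) (use A in auto)
    then show ?case by (simp add: ac_simps)
  qed
  have "summable (\<lambda>k. (c * real n) ^ k / fact k)"
    using summable_exp[of "c * real n"] by (simp add: divide_inverse mult.commute)
  then show ?thesis
  proof (rule summable_comparison_test'[where N = 0])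
    fix k :: nat
    have "norm ((A ^\<^sub>m k) $$ (i, j)) \<le> (c * real n) ^ k"
      using b[of k] A i j by (auto simp: norm_bound_def pow_mat_dim_square)
    then show "norm ((A ^\<^sub>m k) $$ (i, j) / fact k) \<le> (c * real n) ^ k / fact k"
      by (simp add: divide_right_mono)
  qed
qed

definition ph_density :: "real mat \<Rightarrow> real mat \<Rightarrow> real \<Rightarrow> real" where
  "ph_density p Q t = (p * mat_exp (t \<cdot>\<^sub>m Q) * absorbing_rates Q) $$ (0, 0)"

definition ph_equivalent :: "real mat \<Rightarrow> real mat \<Rightarrow> real mat \<Rightarrow> real mat \<Rightarrow> bool" where
  "ph_equivalent pa Qa pb Qb \<longleftrightarrow> (\<forall>t \<ge> 0. ph_density pa Qa t = ph_density pb Qb t)"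

definition transformation_matrix ::
  "nat \<Rightarrow> real mat \<Rightarrow> real mat \<Rightarrow> real mat \<Rightarrow> real mat \<Rightarrow> real mat \<Rightarrow> bool" where
  "transformation_matrix n pa Qa pb Qb M \<longleftrightarrow>
     M \<in> carrier_mat n n \<and>
     pa * M = pb \<and>
     (\<exists>N \<in> carrier_mat n n. inverts_mat M N \<and> inverts_mat N M \<and> Qb = N * Qa * M) \<and>
     M * absorbing_rates Qb = absorbing_rates Qa"

definition lower_triangular :: "real mat \<Rightarrow> bool" where
  "lower_triangular A \<longleftrightarrow> (\<forall>i < dim_row A. \<forall>j < dim_col A. i < j \<longrightarrow> A $$ (i, j) = 0)"

end

theory Submission
  imports Defs
begin

text \<open>
  The condition \<open>p\<^sub>a M = p\<^sub>b\<close> says that the first row of \<open>M\<close> is the first unit row vector. The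
  similarity says that \<open>M\<close> intertwines the generators, \<open>Q\<^sub>a M = M Q\<^sub>b\<close>, and this relation
  propagates the shape of the first row downwards. Indeed, row \<open>i\<close> of \<open>Q\<^sub>a M\<close> is a combination
  of the rows \<open>i\<close> and \<open>i + 1\<close> of \<open>M\<close>, in which row \<open>i + 1\<close> has the non-zero coefficient
  \<open>\<lambda>\<^sub>i\<close>. If row \<open>i\<close> of \<open>M\<close> is supported on the columns up to \<open>i\<close>, then row \<open>i\<close> of \<open>M Q\<^sub>b\<close> is
  supported on the columns up to \<open>i + 1\<close>, because the generator \<open>Q\<^sub>b\<close> moves mass by at most one
  phase. Solving for row \<open>i + 1\<close> of \<open>M\<close> shows that it is supported on the columns up to
  \<open>i + 1\<close>. The lemma \<open>lower_triangular_intertwiner\<close> runs this argument for matrices that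
  vanish above the superdiagonal; entries below the diagonal only bring in rows of \<open>M\<close> whose
  support is already known.
\<close>

text \<open>
  In Krylov terms: for \<open>i < n\<close> the vectors \<open>e\<^sub>0, e\<^sub>0 A, \<dots>, e\<^sub>0 A\<^sup>i\<close> span the same space as
  the first \<open>i + 1\<close> unit row vectors, since the superdiagonal of \<open>A\<close> has no zero. As \<open>e\<^sub>0 M\<close> is
  a multiple of \<open>e\<^sub>0\<close>, right multiplication by \<open>M\<close> takes \<open>e\<^sub>0 A\<^sup>k\<close> to a multiple of
  \<open>e\<^sub>0 B\<^sup>k\<close>, which lies in the span of the first \<open>k + 1\<close> unit row vectors. The induction below
  is this argument entry by entry: it compares the entries \<open>(k, j)\<close> of \<open>A M\<close> and \<open>M B\<close> for
  \<open>j > k + 1\<close>.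
\<close>
lemma lower_triangular_intertwiner:
  fixes A B M :: "real mat"
  assumes A: "A \<in> carrier_mat n n" and B: "B \<in> carrier_mat n n" and M: "M \<in> carrier_mat n n"
    and A_zero: "\<And>i j. i < n \<Longrightarrow> j < n \<Longrightarrow> Suc i < j \<Longrightarrow> A $$ (i, j) = 0"
    and A_super: "\<And>i. Suc i < n \<Longrightarrow> A $$ (i, Suc i) \<noteq> 0"
    and B_zero: "\<And>i j. i < n \<Longrightarrow> j < n \<Longrightarrow> Suc i < j \<Longrightarrow> B $$ (i, j) = 0"
    and inter: "A * M = M * B"
    and first_row: "\<And>j. 0 < j \<Longrightarrow> j < n \<Longrightarrow> M $$ (0, j) = 0"
  shows "lower_triangular M"
proof -
  have "M $$ (i, j) = 0" if "i < j" "j < n" for i j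
    using that
  proof (induction i arbitrary: j rule: less_induct)
    case (less i)
    show ?case
    proof (cases i)
      case 0
      then show ?thesis using first_row less.prems by simp
    next
      case (Suc k)
      have j: "Suc k < j" "j < n" using Suc less.prems by auto
      have "(A * M) $$ (k, j) = (\<Sum>l = 0..<n. A $$ (k, l) * M $$ (l, j))"
        using A M j by (simp add: scalar_prod_def)
      also have "\<dots> = (\<Sum>l = 0..<n. if l = Suc k then A $$ (k, Suc k) * M $$ (Suc k, j) else 0)"
      proof (rule sum.cong)
        fix l assume "l \<in> {0..<n}"
        then consider "l < Suc k" | "l = Suc k" | "Suc k < l" "l < n" by fastforce
        then show "A $$ (k, l) * M $$ (l, j)
            = (if l = Suc k then A $$ (k, Suc k) * M $$ (Suc k, j) else 0)"
          by cases (use A_zero less.IH Suc j in auto)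
      qed simp
      also have "\<dots> = A $$ (k, Suc k) * M $$ (Suc k, j)" using j by simp
      finally have left: "(A * M) $$ (k, j) = A $$ (k, Suc k) * M $$ (Suc k, j)" .
      have "(M * B) $$ (k, j) = (\<Sum>l = 0..<n. M $$ (k, l) * B $$ (l, j))"
        using B M j by (simp add: scalar_prod_def)
      also have "\<dots> = 0"
      proof (rule sum.neutral, rule ballI)
        fix l assume l: "l \<in> {0..<n}"
        show "M $$ (k, l) * B $$ (l, j) = 0"
        proof (cases "k < l")
          case True
          then show ?thesis using less.IH[of k l] Suc l by simp
        next
          case False
          then show ?thesis using B_zero[of l j] l j by simp
        qed
      qed
      finally show ?thesis
        using left inter A_super[of k] j Suc by simp
    qed
  qed
  then show ?thesis using M by (auto simp: lower_triangular_def)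
qed

lemma coxian_generator_carrier: "coxian_generator n lam mu \<in> carrier_mat n n"
  by (simp add: coxian_generator_def)

lemma coxian_generator_above_superdiagonal:
  "i < n \<Longrightarrow> j < n \<Longrightarrow> Suc i < j \<Longrightarrow> coxian_generator n lam mu $$ (i, j) = 0"
  by (simp add: coxian_generator_def)

lemma coxian_generator_superdiagonal:
  "Suc i < n \<Longrightarrow> coxian_generator n lam mu $$ (i, Suc i) = lam i"
  by (simp add: coxian_generator_def)

lemma similarity_intertwines:
  fixes A M N :: "real mat"
  assumes "A \<in> carrier_mat n n" "M \<in> carrier_mat n n" "N \<in> carrier_mat n n"
    and "inverts_mat M N"
  shows "M * (N * A * M) = A * M"
proof -
  have "M * (N * A * M) = M * N * (A * M)"
    using assms by (simp add: assoc_mult_mat[where n\<^sub>1 = n and n\<^sub>2 = n and n\<^sub>3 = n and n\<^sub>4 = n])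
  also have "\<dots> = A * M"
    using assms by (simp add: inverts_mat_def)
  finally show ?thesis .
qed

theorem corollary1:
  fixes n :: nat and pa Qa pb Qb M :: "real mat"
  assumes "is_cph n pa Qa" and "is_cph n pb Qb"
    and "ph_equivalent pa Qa pb Qb"
    and "transformation_matrix n pa Qa pb Qb M"
  shows "lower_triangular M \<and> row M 0 = unit_vec n 0"
proof -
  have n: "0 < n" and pa: "pa = mat 1 n (\<lambda>(i, j). if j = 0 then 1 else 0)"
    using assms(1) by (auto simp: is_cph_def)
  obtain lam mu where lam: "\<forall>i < n - 1. 0 < lam i" and Qa: "Qa = coxian_generator n lam mu"
    using assms(1) by (auto simp: is_cph_def)
  obtain lam' mu' where Qb: "Qb = coxian_generator n lam' mu'"
    using assms(2) by (auto simp: is_cph_def)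
  have pb: "pb = mat 1 n (\<lambda>(i, j). if j = 0 then 1 else 0)"
    using assms(2) by (simp add: is_cph_def)
  obtain N where M: "M \<in> carrier_mat n n" and N: "N \<in> carrier_mat n n"
    and pM: "pa * M = pb" and inv: "inverts_mat M N" and sim: "Qb = N * Qa * M"
    using assms(4) by (auto simp: transformation_matrix_def)
  have "row pa 0 = unit_vec n 0"
    using n by (intro eq_vecI) (auto simp: pa)
  then have entry: "M $$ (0, j) = (if j = 0 then 1 else 0)" if "j < n" for j
    using arg_cong[OF pM, of "\<lambda>X. X $$ (0, j)"] that n M
    by (simp add: pa pb)
  have "lower_triangular M"
  proof (rule lower_triangular_intertwiner)
    show "Qa * M = M * Qb"
      using similarity_intertwines[OF _ M N inv, of Qa] coxian_generator_carrier sim Qa by simp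
    show "Qa $$ (i, Suc i) \<noteq> 0" if "Suc i < n" for i
    proof -
      have "0 < lam i" using lam that by simp
      then show ?thesis using that by (simp add: Qa coxian_generator_superdiagonal)
    qed
  qed (use M entry in \<open>auto simp: Qa Qb coxian_generator_carrier coxian_generator_above_superdiagonal\<close>)
  moreover have "row M 0 = unit_vec n 0"
    using M n by (intro eq_vecI) (auto simp: entry)
  ultimately show ?thesis ..
qed

end
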